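(* For every integer $n\ge 1$ and every real $x\ge 0$, $$\sum_{j=0}^{n-1}\frac{x^{2j}}{(j!)^2}\le \exp\Big(2x\cos\frac{\pi}{n+1}\Big).$$
   Context: The left-hand side is a partial sum of $I_0(2x)=\sum_{j=0}^\infty \frac{x^{2j}}{(j!)^2}$, where $I_0$ is the modified Bessel function of the first kind of order zero. The convention $x^0=1$ is used, including at $x=0$. *)

theory Defs
  imports Complex_Main
begin

end

theory Submission
  imports Defs
begin

text \<open>
  Put \<open>u\<^sub>j(x) = x\<^sup>j / j!\<close>, so that \<open>u\<^sub>j\<^sub>+\<^sub>1' = u\<^sub>j\<close>, and let \<open>F\<close> be the sum of the
  \<open>u\<^sub>j\<^sup>2\<close> over \<open>j < n\<close>. Then \<open>F'\<close> is the adjacency quadratic form of the path on \<open>n\<close> vertices,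
  evaluated at \<open>u\<close>. The largest eigenvalue of the path is \<open>2 cos (\<pi> / (n + 1))\<close>, hence
  \<open>F' \<le> 2 cos (\<pi> / (n + 1)) F\<close>, and Gronwall's argument with \<open>F(0) = 1\<close> gives the bound.
\<close>

text \<open>
  The induction splits each product \<open>u\<^sub>j u\<^sub>j\<^sub>+\<^sub>1\<close> by AM-GM, weighted by the Perron eigenvector
  \<open>sin ((j + 1) \<theta>)\<close>; the extra term on the left is the weight left over at the last vertex.
\<close>

lemma path_form_le_aux:
  fixes u :: "nat \<Rightarrow> real"
  assumes "\<theta> > 0" and "real (Suc m) * \<theta> < pi"
  shows "2 * (\<Sum>j<m. u j * u (Suc j)) + sin (real (m + 2) * \<theta>) / sin (real (m + 1) * \<theta>) * (u m)\<^sup>2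
    \<le> 2 * cos \<theta> * (\<Sum>j\<le>m. (u j)\<^sup>2)"
  using assms
proof (induction m)
  case 0
  then have "sin \<theta> > 0"
    by (intro sin_gt_zero) auto
  then show ?case
    by (simp add: sin_double)
next
  case (Suc m)
  define s where "s k = sin (real k * \<theta>)" for k
  define a where "a = s (m + 2) / s (m + 1)"
  have lt: "real (m + 2) * \<theta> < pi" "real (m + 1) * \<theta> < pi"
    using Suc.prems by (auto simp: algebra_simps)
  then have pos: "s (m + 1) > 0" "s (m + 2) > 0"
    using \<open>\<theta> > 0\<close> by (auto simp: s_def intro!: sin_gt_zero)
  \<comment> \<open>The eigenvector equation of the path at an inner vertex. It makes the next
    leftover weight \<open>2 * cos \<theta> - 1 / a\<close>, so the \<open>1 / a\<close> terms
    cancel against AM-GM.\<close>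
  have "s (m + 3) + s (m + 1) = 2 * cos \<theta> * s (m + 2)"
    using sin_add[of "real (m + 2) * \<theta>" \<theta>] sin_diff[of "real (m + 2) * \<theta>" \<theta>]
    by (simp add: s_def algebra_simps)
  then have "s (m + 3) / s (m + 2) = 2 * cos \<theta> - 1 / a"
    using pos by (simp add: a_def field_simps)
  then have b: "s (m + 3) / s (m + 2) * (u (Suc m))\<^sup>2
    = 2 * cos \<theta> * (u (Suc m))\<^sup>2 - (u (Suc m))\<^sup>2 / a"
    by (simp only: left_diff_distrib) simp
  have "a > 0"
    using pos by (simp add: a_def)
  have "0 \<le> (a * u m - u (Suc m))\<^sup>2 / a"
    using \<open>a > 0\<close> by simp
  also have "\<dots> = a * (u m)\<^sup>2 + (u (Suc m))\<^sup>2 / a - 2 * (u m * u (Suc m))"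
    using \<open>a > 0\<close> by (simp add: field_simps power2_eq_square)
  finally have amgm: "2 * (u m * u (Suc m)) \<le> a * (u m)\<^sup>2 + (u (Suc m))\<^sup>2 / a"
    by simp
  have IH: "2 * (\<Sum>j<m. u j * u (Suc j)) + a * (u m)\<^sup>2 \<le> 2 * cos \<theta> * (\<Sum>j\<le>m. (u j)\<^sup>2)"
    using Suc.IH \<open>\<theta> > 0\<close> lt by (simp add: a_def s_def)
  have "2 * (\<Sum>j<Suc m. u j * u (Suc j)) + s (m + 3) / s (m + 2) * (u (Suc m))\<^sup>2
    \<le> 2 * cos \<theta> * (\<Sum>j\<le>Suc m. (u j)\<^sup>2)"
    unfolding b sum.lessThan_Suc sum.atMost_Suc distrib_left using IH amgm by linarith
  then show ?case
    by (simp add: s_def numeral_eq_Suc)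
qed

text \<open>At \<theta> = pi / (m + 2) the leftover weight vanishes, its numerator being sin
  pi.\<close>

lemma path_form_le:
  fixes u :: "nat \<Rightarrow> real"
  shows "(\<Sum>j<m. u j * u (Suc j)) \<le> cos (pi / real (m + 2)) * (\<Sum>j\<le>m. (u j)\<^sup>2)"
proof -
  let ?\<theta> = "pi / real (m + 2)"
  have "real (Suc m) * ?\<theta> < pi"
    by (simp add: field_simps)
  moreover have "sin (real (m + 2) * ?\<theta>) = 0"
    by (simp del: of_nat_add)
  ultimately show ?thesis
    using path_form_le_aux[of ?\<theta> m u] by simp
qed

text \<open>With the integrating factor \<open>exp (- c * t)\<close>, the product with
  \<open>F t\<close> has nonpositive derivative.\<close>

lemma le_exp_of_deriv_le:
  fixes F :: "real \<Rightarrow> real"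
  assumes deriv: "\<And>t. (F has_real_derivative F' t) (at t)"
    and le: "\<And>t. F' t \<le> c * F t" and "x \<ge> 0"
  shows "F x \<le> F 0 * exp (c * x)"
proof -
  have "F x * exp (- c * x) \<le> F 0 * exp (- c * 0)"
  proof (rule DERIV_nonpos_imp_nonincreasing[OF \<open>x \<ge> 0\<close>])
    fix t
    have "((\<lambda>t. F t * exp (- c * t)) has_real_derivative (F' t - c * F t) * exp (- c * t)) (at t)"
      by (auto intro!: derivative_eq_intros deriv simp: algebra_simps)
    moreover have "(F' t - c * F t) * exp (- c * t) \<le> 0"
      using le[of t] by (simp add: mult_nonpos_nonneg)
    ultimately show "\<exists>y. ((\<lambda>t. F t * exp (- c * t)) has_real_derivative y) (at t) \<and> y \<le> 0"
      by blast
  qed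
  then show ?thesis
    by (simp add: exp_minus field_simps)
qed

theorem mainTheorem3:
  fixes n :: nat and x :: real
  assumes "n \<ge> 1" and "x \<ge> 0"
  shows "(\<Sum>j<n. x ^ (2 * j) / (fact j)\<^sup>2) \<le> exp (2 * x * cos (pi / real (n + 1)))"
proof -
  obtain m where n: "n = Suc m"
    using \<open>n \<ge> 1\<close> by (cases n) auto
  define u :: "nat \<Rightarrow> real \<Rightarrow> real" where "u j t = t ^ j / fact j" for j t
  define F where "F t = (\<Sum>j\<le>m. (u j t)\<^sup>2)" for t
  define F' where "F' t = 2 * (\<Sum>j<m. u j t * u (Suc j) t)" for t
  let ?c = "2 * cos (pi / real (m + 2))"
  have u_deriv: "(u (Suc j) has_real_derivative u j t) (at t)" for j t
    using DERIV_cdivide[OF DERIV_pow[of "Suc j" t UNIV], of "fact (Suc j)"]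
    by (simp add: u_def[abs_def] del: of_nat_Suc)
  \<comment> \<open>The constant term j = 0 is split off, since \<open>u_deriv\<close> covers only
    successor indices.\<close>
  have F_eq: "F t = 1 + (\<Sum>j<m. (u (Suc j) t)\<^sup>2)" for t
    by (simp add: F_def u_def sum.atMost_shift)
  have "(F has_real_derivative F' t) (at t)" for t
    unfolding F_eq[abs_def] F'_def
    by (auto intro!: derivative_eq_intros u_deriv simp: sum_distrib_left mult_ac)
  moreover have "F' t \<le> ?c * F t" for t
    using path_form_le[of "\<lambda>j. u j t" m] by (simp add: F_def F'_def)
  ultimately have "F x \<le> F 0 * exp (?c * x)"
    using \<open>x \<ge> 0\<close> by (rule le_exp_of_deriv_le)
  moreover have "F 0 = 1"
    by (simp add: F_eq u_def)
  moreover have "(\<Sum>j<n. x ^ (2 * j) / (fact j)\<^sup>2) = F x"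
    by (simp add: F_def u_def n lessThan_Suc_atMost power_divide power_even_eq)
  ultimately show ?thesis
    by (simp add: n mult_ac)
qed

end
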